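(* Every modular quasi-lattice $(P,\leq)$ is a lattice.
   Context: Let $(P,\leq)$ be a poset on a nonempty set $P$. An element $m\in P$ is a maximal lower bound of a nonempty subset $S\subseteq P$ if $m\leq s$ for all $s\in S$ and there is no $d\in P$ with $m<d\leq s$ for all $s\in S$; a minimal upper bound is defined dually. $(P,\leq)$ is a quasi-lattice if any two elements of $P$ have at least one minimal upper bound and at least one maximal lower bound (these need not be unique). For subsets $A,B\subseteq P$, $A\vee B$ denotes the set of all elements of $P$ that are a minimal upper bound of $\{a,b\}$ for some $a\in A$, $b\in B$, and $A\wedge B$ denotes the set of all elements of $P$ that are a maximal lower bound of $\{a,b\}$ for some $a\in A$, $b\in B$. A quasi-lattice $(P,\leq)$ is called modular if $\{x\}\vee(\{y\}\wedge\{z\})=(\{x\}\vee\{y\})\wedge\{z\}$ (equality of subsets of $P$) whenever $x,y,z\in P$ and $x\leq z$. A lattice is a poset in which any two elements have a least upper bound and a greatest lower bound. *)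

theory Defs
  imports "HOL-Algebra.Lattice"
begin

definition minimal_upper_bound :: "('a, 'b) gorder_scheme \<Rightarrow> 'a \<Rightarrow> 'a set \<Rightarrow> bool" where
  "minimal_upper_bound L m S \<longleftrightarrow>
     m \<in> Upper L S \<and> \<not> (\<exists>d \<in> Upper L S. d \<sqsubset>\<^bsub>L\<^esub> m)"

definition maximal_lower_bound :: "('a, 'b) gorder_scheme \<Rightarrow> 'a \<Rightarrow> 'a set \<Rightarrow> bool" where
  "maximal_lower_bound L m S \<longleftrightarrow>
     m \<in> Lower L S \<and> \<not> (\<exists>d \<in> Lower L S. m \<sqsubset>\<^bsub>L\<^esub> d)"

definition set_join :: "('a, 'b) gorder_scheme \<Rightarrow> 'a set \<Rightarrow> 'a set \<Rightarrow> 'a set" where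
  "set_join L A B = {m. \<exists>a\<in>A. \<exists>b\<in>B. minimal_upper_bound L m {a, b}}"

definition set_meet :: "('a, 'b) gorder_scheme \<Rightarrow> 'a set \<Rightarrow> 'a set \<Rightarrow> 'a set" where
  "set_meet L A B = {m. \<exists>a\<in>A. \<exists>b\<in>B. maximal_lower_bound L m {a, b}}"

(* The locale partial_order, unlike weak_partial_order, has genuine equality as its
   equivalence, so L is an ordinary poset with underlying set carrier L. *)
locale quasi_lattice = partial_order L for L (structure) +
  assumes carrier_nonempty: "carrier L \<noteq> {}"
    and minimal_upper_bound_exists:
      "\<lbrakk>x \<in> carrier L; y \<in> carrier L\<rbrakk> \<Longrightarrow> \<exists>m. minimal_upper_bound L m {x, y}"
    and maximal_lower_bound_exists:
      "\<lbrakk>x \<in> carrier L; y \<in> carrier L\<rbrakk> \<Longrightarrow> \<exists>m. maximal_lower_bound L m {x, y}"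

locale modular_quasi_lattice = quasi_lattice +
  assumes modular:
    "\<lbrakk>x \<in> carrier L; y \<in> carrier L; z \<in> carrier L; x \<sqsubseteq> z\<rbrakk> \<Longrightarrow>
       set_join L {x} (set_meet L {y} {z}) = set_meet L (set_join L {x} {y}) {z}"

end

theory Submission
  imports Defs
begin

text \<open>If \<open>d\<close> is a lower bound of \<open>{y, z}\<close>, then \<open>{d} \<or> {y} = {y}\<close>, so the modular law reads
  \<open>{d} \<or> ({y} \<and> {z}) = {y} \<and> {z}\<close>. Every element of the left-hand side lies above \<open>d\<close>, hence so
  does every maximal lower bound of \<open>{y, z}\<close>. Minimal upper bounds are treated dually.\<close>

context partial_order
begin

text \<open>\<open>y\<close> is itself an upper bound and lies below every other one. This collapses
  the inner join in the modular law.\<close>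

lemma minimal_upper_bound_of_le:
  assumes "x \<in> carrier L" "y \<in> carrier L" "x \<sqsubseteq> y"
  shows "minimal_upper_bound L m {x, y} \<longleftrightarrow> m = y"
  using assms by (auto simp: minimal_upper_bound_def Upper_def lless_eq intro: le_antisym)

lemma maximal_lower_bound_of_le:
  assumes "x \<in> carrier L" "y \<in> carrier L" "x \<sqsubseteq> y"
  shows "maximal_lower_bound L m {x, y} \<longleftrightarrow> m = x"
  using assms by (auto simp: maximal_lower_bound_def Lower_def lless_eq intro: le_antisym)

end

context modular_quasi_lattice
begin

lemma maximal_lower_bound_imp_greatest:
  assumes y: "y \<in> carrier L" and z: "z \<in> carrier L" and m: "maximal_lower_bound L m {y, z}"
  shows "greatest L m (Lower L {y, z})"
proof -
  have "d \<sqsubseteq> m" if d: "d \<in> Lower L {y, z}" for d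
  proof -
    have dc: "d \<in> carrier L" "d \<sqsubseteq> y" "d \<sqsubseteq> z"
      using d y z by (auto simp: Lower_def)
    have "set_join L {d} {y} = {y}"
      using dc y by (auto simp: set_join_def minimal_upper_bound_of_le)
    \<comment> \<open>\<open>d \<sqsubseteq> y\<close> has collapsed the inner join;
      \<open>d \<sqsubseteq> z\<close> is the side condition of \<open>modular\<close>.\<close>
    with m have "m \<in> set_join L {d} (set_meet L {y} {z})"
      using modular[OF dc(1) y z dc(3)] by (auto simp: set_meet_def)
    then show ?thesis
      using dc by (auto simp: set_join_def minimal_upper_bound_def Upper_def)
  qed
  then show ?thesis
    using m y z by (auto simp: greatest_def maximal_lower_bound_def)
qed

text \<open>Reversing the order and exchanging \<open>x\<close> with \<open>z\<close> turns the
  modular law into itself. Here an upper bound \<open>u\<close> takes the place of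
  \<open>z\<close>.\<close>

lemma minimal_upper_bound_imp_least:
  assumes x: "x \<in> carrier L" and y: "y \<in> carrier L" and m: "minimal_upper_bound L m {x, y}"
  shows "least L m (Upper L {x, y})"
proof -
  have "m \<sqsubseteq> u" if u: "u \<in> Upper L {x, y}" for u
  proof -
    have uc: "u \<in> carrier L" "x \<sqsubseteq> u" "y \<sqsubseteq> u"
      using u x y by (auto simp: Upper_def)
    have "set_meet L {y} {u} = {y}"
      using uc y by (auto simp: set_meet_def maximal_lower_bound_of_le)
    with m have "m \<in> set_meet L (set_join L {x} {y}) {u}"
      using modular[OF x y uc(1) uc(2)] by (auto simp: set_join_def)
    \<comment> \<open>\<open>m\<close> is a maximal lower bound of \<open>u\<close> and some element
      of the join, so in particular it lies below \<open>u\<close>.\<close>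
    then show ?thesis
      using uc by (auto simp: set_meet_def maximal_lower_bound_def Lower_def)
  qed
  then show ?thesis
    using m x y by (auto simp: least_def minimal_upper_bound_def)
qed

end

theorem theorem3p2:
  fixes L :: "('a, 'b) gorder_scheme"
  assumes "modular_quasi_lattice L"
  shows "lattice L"
proof -
  interpret modular_quasi_lattice L by fact
  show ?thesis
  proof unfold_locales
    fix x y assume xy: "x \<in> carrier L" "y \<in> carrier L"
    show "\<exists>s. least L s (Upper L {x, y})"
      using minimal_upper_bound_exists[OF xy] minimal_upper_bound_imp_least[OF xy] by blast
    show "\<exists>s. greatest L s (Lower L {x, y})"
      using maximal_lower_bound_exists[OF xy] maximal_lower_bound_imp_greatest[OF xy] by blast
  qed
qed

end
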